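(* Let $f,g\in\mathcal{A}$, $\lambda\in[0,1)$, $c\in\mathbb{C}$ with $c\neq 0$, and let $p,b\in\mathbb{R}$ be such that $\kappa=p+\frac{b+1}{2}>-1$. Put $$\Phi(z)=(1-\lambda)\frac{B_{\kappa+1,c}(g)(z)}{z}+\lambda\frac{B_{\kappa+2,c}(g)(z)}{z},\qquad z\in\mathbb{D},$$ and suppose that $$\operatorname{Re}\left(\frac{z\Phi''(z)}{\Phi'(z)}+1\right)>-\gamma_{\lambda,\kappa}\quad\text{for all } z\in\mathbb{D},$$ where $$\gamma_{\lambda,\kappa}=\frac{(1-\lambda)^2+(\kappa+1)^2-\sqrt{(1-\lambda)^4+(\kappa+1)^4}}{4(1-\lambda)(\kappa+1)}.$$ Then the subordination $$(1-\lambda)\frac{B_{\kappa+1,c}(f)(z)}{z}+\lambda\frac{B_{\kappa+2,c}(f)(z)}{z}\prec(1-\lambda)\frac{B_{\kappa+1,c}(g)(z)}{z}+\lambda\frac{B_{\kappa+2,c}(g)(z)}{z}$$ implies that $$\frac{B_{\kappa+2,c}(f)(z)}{z}\prec\frac{B_{\kappa+2,c}(g)(z)}{z}.$$ Moreover, the function $z\mapsto B_{\kappa+2,c}(g)(z)/z$ is the best dominant of the differential subordination $P(z)+\frac{1-\lambda}{\kappa+1}\,zP'(z)\prec\Phi(z)$.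
   Context: $\mathbb{D}=\{z\in\mathbb{C}:|z|<1\}$. $\mathcal{A}$ is the class of functions $f(z)=z+\sum_{n\ge1}a_{n+1}z^{n+1}$ that are analytic and univalent (injective) in $\mathbb{D}$. For $\nu\in\mathbb{C}\setminus\{0,-1,-2,\dots\}$ and $c\in\mathbb{C}\setminus\{0\}$, and $f(z)=z+\sum_{n\ge1}a_{n+1}z^{n+1}$ analytic in $\mathbb{D}$, define $$B_{\nu,c}(f)(z)=z+\sum_{n\ge1}a_{n+1}\frac{(-c/4)^n}{(\nu)_n}\frac{z^{n+1}}{n!},\qquad (\nu)_n=\nu(\nu+1)\cdots(\nu+n-1).$$ Expressions such as $B_{\nu,c}(f)(z)/z$ are understood to be extended analytically to $z=0$ (with value $1$). Subordination: for $f,F$ analytic in $\mathbb{D}$, $f\prec F$ means there is $w$ analytic in $\mathbb{D}$ with $|w(z)|\le|z|$ and $f(z)=F(w(z))$ for all $z\in\mathbb{D}$. Best dominant: let $\varphi:\mathbb{C}^2\to\mathbb{C}$ and let $h$ be univalent in $\mathbb{D}$. A solution of the differential subordination $\varphi(P(z),zP'(z))\prec h(z)$ is an analytic function $P$ in $\mathbb{D}$ satisfying it. A univalent function $q$ is a dominant if $P\prec q$ for all solutions $P$. A dominant $\tilde q$ with $\tilde q\prec q$ for all dominants $q$ is the best dominant. (Here $\varphi(u,v)=u+\frac{1-\lambda}{\kappa+1}v$ and $h=\Phi$.) The hypothesis on $z\Phi''(z)/\Phi'(z)$ is understood to include that $\Phi'(z)\ne0$ in $\mathbb{D}$, so that the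 quotient is defined. *)

theory Defs
  imports "HOL-Complex_Analysis.Complex_Analysis"
begin

definition univalent :: "(complex \<Rightarrow> complex) \<Rightarrow> bool" where
  "univalent f \<longleftrightarrow> f holomorphic_on ball 0 1 \<and> inj_on f (ball 0 1)"

definition class_A :: "(complex \<Rightarrow> complex) set" where
  "class_A = {f. univalent f \<and> f 0 = 0 \<and> deriv f 0 = 1}"

text \<open>
  The sum over \<open>n \<ge> 1\<close> of the terms with coefficient \<open>a\<^sub>n\<^sub>+\<^sub>1\<close>, where \<open>a\<^sub>k\<close> is the \<open>k\<close>-th
  Taylor coefficient of \<open>f\<close> at \<open>0\<close>, is written as a series over \<open>Suc n\<close>. The operator is only
  meaningful if \<open>\<nu>\<close> is not a non-positive integer and \<open>f\<close> is holomorphic on the unit disc with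
  \<open>f 0 = 0\<close> and \<open>deriv f 0 = 1\<close>.
\<close>
definition B_op :: "complex \<Rightarrow> complex \<Rightarrow> (complex \<Rightarrow> complex) \<Rightarrow> complex \<Rightarrow> complex" where
  "B_op \<nu> c f z = z + (\<Sum>n. fps_nth (fps_expansion f 0) (Suc n + 1) *
      ((- c / 4) ^ Suc n / pochhammer \<nu> (Suc n)) * (z ^ (Suc n + 1) / fact (Suc n)))"

text \<open>The quotient \<open>B_op \<nu> c f z / z\<close>, with its removable singularity at \<open>0\<close> filled in.\<close>
definition B_quot :: "complex \<Rightarrow> complex \<Rightarrow> (complex \<Rightarrow> complex) \<Rightarrow> complex \<Rightarrow> complex" where
  "B_quot \<nu> c f z = (if z = 0 then 1 else B_op \<nu> c f z / z)"

definition B_mix :: "real \<Rightarrow> real \<Rightarrow> complex \<Rightarrow> (complex \<Rightarrow> complex) \<Rightarrow> complex \<Rightarrow> complex" where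
  "B_mix lam \<kappa> c f z =
     (1 - of_real lam) * B_quot (of_real \<kappa> + 1) c f z + of_real lam * B_quot (of_real \<kappa> + 2) c f z"

definition gamma_bound :: "real \<Rightarrow> real \<Rightarrow> real" where
  "gamma_bound lam \<kappa> =
     ((1 - lam)\<^sup>2 + (\<kappa> + 1)\<^sup>2 - sqrt ((1 - lam) ^ 4 + (\<kappa> + 1) ^ 4)) / (4 * (1 - lam) * (\<kappa> + 1))"

definition subordinate :: "(complex \<Rightarrow> complex) \<Rightarrow> (complex \<Rightarrow> complex) \<Rightarrow> bool" where
  "subordinate f F \<longleftrightarrow>
     f holomorphic_on ball 0 1 \<and> F holomorphic_on ball 0 1 \<and>
     (\<exists>w. w holomorphic_on ball 0 1 \<and>
          (\<forall>z\<in>ball 0 1. norm (w z) \<le> norm z \<and> f z = F (w z)))"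

text \<open>Solutions, dominants and best dominants of \<open>\<phi>(P(z), z P'(z)) \<prec> h(z)\<close>.\<close>
definition ds_solution ::
  "(complex \<Rightarrow> complex \<Rightarrow> complex) \<Rightarrow> (complex \<Rightarrow> complex) \<Rightarrow> (complex \<Rightarrow> complex) \<Rightarrow> bool" where
  "ds_solution \<phi> h P \<longleftrightarrow>
     P holomorphic_on ball 0 1 \<and> subordinate (\<lambda>z. \<phi> (P z) (z * deriv P z)) h"

definition ds_dominant ::
  "(complex \<Rightarrow> complex \<Rightarrow> complex) \<Rightarrow> (complex \<Rightarrow> complex) \<Rightarrow> (complex \<Rightarrow> complex) \<Rightarrow> bool" where
  "ds_dominant \<phi> h q \<longleftrightarrow> univalent q \<and> (\<forall>P. ds_solution \<phi> h P \<longrightarrow> subordinate P q)"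

text \<open>
  Best dominants are only considered for univalent \<open>h\<close>; this requirement is part of the predicate.
\<close>
definition ds_best_dominant ::
  "(complex \<Rightarrow> complex \<Rightarrow> complex) \<Rightarrow> (complex \<Rightarrow> complex) \<Rightarrow> (complex \<Rightarrow> complex) \<Rightarrow> bool" where
  "ds_best_dominant \<phi> h q \<longleftrightarrow>
     univalent h \<and> ds_dominant \<phi> h q \<and> (\<forall>r. ds_dominant \<phi> h r \<longrightarrow> subordinate q r)"

end

theory Submission
  imports Defs
begin

text \<open>
  Put \<open>\<beta> = (\<kappa> + 1) / (1 - lam)\<close> and let \<open>q\<close> be the quotient \<open>B_quot (\<kappa> + 2) c g\<close>. Comparing
  coefficients, \<open>\<Phi> = q + z q' / \<beta>\<close>, so \<open>Q = 1 + z q'' / q'\<close> satisfies the Briot--Bouquet equation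
  \<open>Q + z Q' / (Q + \<beta>) = 1 + z \<Phi>'' / \<Phi>'\<close>. Jack's lemma at a first point where \<open>Re Q = 0\<close>, together
  with \<open>gamma_bound lam \<kappa> \<le> min (\<beta> / 2) (1 / (2 * \<beta>))\<close>, shows \<open>Re Q > 0\<close>, so \<open>q\<close> is convex. Convexity
  makes \<open>z q'\<close> a monotone function of \<open>q\<close> and an outward normal to the images of discs. This gives
  injectivity of \<open>\<Phi>\<close>, and it excludes \<open>P(y) = q(u)\<close>, \<open>y P'(y) = k u q'(u)\<close>, \<open>k \<ge> 1\<close> at a first point
  where \<open>u = q\<^sup>-\<^sup>1(P(y))\<close> exceeds \<open>y\<close> in modulus, whence \<open>P \<prec> q\<close> for every solution \<open>P\<close>. As \<open>q\<close>
  is itself a solution, it is the best dominant.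
\<close>

subsection \<open>Jack's lemma\<close>

text \<open>Rescaling by \<open>r\<close> and \<open>M\<close> reduces this to the Schwarz lemma on
  the unit disc.\<close>

lemma Schwarz_ball_le:
  assumes holo: "f holomorphic_on ball 0 r" and r: "0 < r" and f0: "f 0 = 0"
    and bound: "\<And>z. z \<in> ball 0 r \<Longrightarrow> norm (f z) \<le> M"
    and z: "z \<in> ball 0 r"
  shows "norm (f z) \<le> M * (norm z / r)"
proof -
  have M: "0 \<le> M" using bound[of 0] r f0 by simp
  \<comment> \<open>The Schwarz lemma asks for values of modulus below 1, while \<open>M\<close> may
    be attained or be 0. Dividing by \<open>M + e\<close> settles both; \<open>e\<close> is removed
    at the end.\<close>
  have strict: "norm (f z) \<le> (M + e) * (norm z / r)" if e: "0 < e" for e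
  proof -
    define h where "h = (\<lambda>x. f (of_real r * x) / of_real (M + e))"
    have mem: "of_real r * x \<in> ball 0 r" if "x \<in> ball 0 1" for x :: complex
      using that r by (simp add: norm_mult)
    have "h holomorphic_on ball 0 1"
      unfolding h_def using mem M e
      by (intro holomorphic_intros holomorphic_on_compose_gen[OF _ holo, unfolded o_def]) auto
    moreover have "h 0 = 0" by (simp add: h_def f0)
    moreover have "norm (h x) < 1" if "norm x < 1" for x
    proof -
      have "norm (f (of_real r * x)) \<le> M" using mem[of x] that by (intro bound) simp
      then show ?thesis using M e unfolding h_def norm_divide norm_of_real by (simp add: divide_simps)
    qed
    moreover have "norm (z / of_real r) < 1" using z r by (simp add: norm_divide)
    ultimately have "norm (h (z / of_real r)) \<le> norm (z / of_real r)"
      by (rule Schwarz_Lemma(1))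
    then show ?thesis using M e r unfolding h_def norm_divide norm_of_real
      by (simp add: field_simps)
  qed
  show ?thesis
  proof (rule field_le_epsilon)
    fix e :: real assume e: "0 < e"
    have "norm (f z) \<le> (M + e) * (norm z / r)" by (rule strict[OF e])
    also have "\<dots> = M * (norm z / r) + e * (norm z / r)" by (simp add: algebra_simps add_divide_distrib)
    also have "e * (norm z / r) \<le> e * 1"
      using e z r by (intro mult_left_mono) auto
    finally show "norm (f z) \<le> M * (norm z / r) + e" by simp
  qed
qed

text \<open>The logarithmic derivative of \<open>W\<close> at \<open>z0\<close> has vanishing
  imaginary part because \<open>norm W\<close> is stationary along the circle, and real part at
  least 1 because the Schwarz lemma bounds \<open>W\<close> linearly along the radius. The open set
  \<open>S\<close> allows for a \<open>W\<close> that is a quotient with poles or involves an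
  inverse function.\<close>

lemma Jack_lemma:
  assumes holo: "W holomorphic_on S" and S: "open S" and ball: "ball 0 r \<subseteq> S"
    and z0: "z0 \<in> S" "norm z0 = r" "z0 \<noteq> 0" and W0: "W 0 = 0" and nz: "W z0 \<noteq> 0"
    and max: "\<And>z. z \<in> S \<Longrightarrow> norm z \<le> r \<Longrightarrow> norm (W z) \<le> norm (W z0)"
  obtains k :: real where "1 \<le> k" "z0 * deriv W z0 = of_real k * W z0"
proof -
  have r: "0 < r" using z0 by auto
  define L where "L = z0 * deriv W z0 / W z0"
  have dW: "(W has_field_derivative deriv W z0) (at z0)"
    using holo S z0(1) by (rule holomorphic_derivI)
  define u where "u = (\<lambda>t::real. Re (W (of_real t * z0) / W z0))"
  have du: "(u has_real_derivative Re L) (at 1)"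
  proof -
    have "((\<lambda>t::complex. W (t * z0) / W z0) has_field_derivative L) (at (of_real 1))"
      using dW nz unfolding L_def
      by (auto intro!: derivative_eq_intros DERIV_chain2[of W _ "\<lambda>t. t * z0"])
    then show ?thesis unfolding u_def
      by (rule has_field_derivative_Re[OF has_vector_derivative_real_field, unfolded o_def])
  qed
  have "1 \<le> Re L"
  proof (rule ccontr)
    assume "\<not> 1 \<le> Re L"
    then have neg: "Re L - 1 < 0" by simp
    \<comment> \<open>Were \<open>Re L < 1\<close>, \<open>u t - t\<close> would strictly decrease
      at 1, so \<open>u (1 - h) > 1 - h\<close> for small \<open>h\<close>, against the Schwarz
      bound.\<close>
    have "((\<lambda>t. u t - t) has_real_derivative Re L - 1) (at 1)"
      using du by (auto intro!: derivative_eq_intros)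
    from DERIV_neg_dec_left[OF this neg] obtain d where d: "0 < d"
      and dec: "\<And>h. 0 < h \<Longrightarrow> h < d \<Longrightarrow> u 1 - 1 < u (1 - h) - (1 - h)" by auto
    define h where "h = min (d/2) (1/2)"
    have h: "0 < h" "h < d" "h < 1" using d by (auto simp: h_def)
    have inb: "of_real (1 - h) * z0 \<in> ball 0 r"
      using h r z0 by (simp add: norm_mult del: of_real_diff)
    have "norm (W (of_real (1 - h) * z0)) \<le> norm (W z0) * (norm (of_real (1 - h) * z0) / r)"
      using holomorphic_on_subset[OF holo ball] r W0 _ inb
    proof (rule Schwarz_ball_le)
      show "norm (W z) \<le> norm (W z0)" if "z \<in> ball 0 r" for z
        using that ball by (intro max) auto
    qed
    also have "\<dots> = norm (W z0) * (1 - h)" using h r z0 by (simp add: norm_mult del: of_real_diff)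
    finally have "norm (W (of_real (1 - h) * z0) / W z0) \<le> 1 - h"
      using nz by (simp add: norm_divide field_simps)
    then have "u (1 - h) \<le> 1 - h"
      unfolding u_def using complex_Re_le_cmod order_trans by blast
    moreover have "u 1 = 1" using nz by (simp add: u_def)
    ultimately show False using dec[OF h(1,2)] by simp
  qed
  moreover have "Im L = 0"
  proof -
    \<comment> \<open>Now \<open>z0\<close> is rotated: \<open>s\<close> has a local maximum at 0,
      so its derivative \<open>Re (\<i> * L) = - Im L\<close> vanishes there.\<close>
    define s where "s = (\<lambda>t::real. Re (W (z0 * exp (\<i> * of_real t)) / W z0))"
    have ds: "(s has_real_derivative Re (\<i> * L)) (at 0)"
    proof -
      have "((\<lambda>t. W (z0 * exp (\<i> * t)) / W z0) has_field_derivative \<i> * L) (at (of_real 0))"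
        using dW nz unfolding L_def
        by (auto intro!: derivative_eq_intros DERIV_chain2[of W _ "\<lambda>t. z0 * exp (\<i> * t)"])
      then show ?thesis unfolding s_def
        by (rule has_field_derivative_Re[OF has_vector_derivative_real_field, unfolded o_def])
    qed
    have cont: "isCont (\<lambda>t::real. z0 * exp (\<i> * of_real t)) 0" by (intro continuous_intros)
    have "\<forall>\<^sub>F t in at (0::real). z0 * exp (\<i> * of_real t) \<in> S"
      using cont S z0(1) unfolding isCont_def by (intro topological_tendstoD) auto
    then obtain d where d: "0 < d"
      and dS: "\<And>t. t \<noteq> 0 \<Longrightarrow> \<bar>t\<bar> < d \<Longrightarrow> z0 * exp (\<i> * of_real t) \<in> S"
      unfolding eventually_at dist_real_def by auto
    have "Re (\<i> * L) = 0"
    proof (rule DERIV_local_max[OF ds d], intro allI impI)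
      fix t :: real assume t: "\<bar>0 - t\<bar> < d"
      have "z0 * exp (\<i> * of_real t) \<in> S" using dS[of t] t z0(1) by (cases "t = 0") auto
      then have "norm (W (z0 * exp (\<i> * of_real t)) / W z0) \<le> 1"
        using max[of "z0 * exp (\<i> * of_real t)"] nz z0 by (simp add: norm_mult norm_divide)
      then have "s t \<le> 1" unfolding s_def using complex_Re_le_cmod order_trans by blast
      moreover have "s 0 = 1" using nz by (simp add: s_def)
      ultimately show "s t \<le> s 0" by simp
    qed
    then show ?thesis by simp
  qed
  ultimately have "L = of_real (Re L)" "1 \<le> Re L" by (auto simp: complex_eq_iff)
  moreover have "z0 * deriv W z0 = L * W z0" using nz by (simp add: L_def)
  ultimately show thesis using that[of "Re L"] by metis
qed


subsection \<open>A Briot--Bouquet differential equation\<close>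

text \<open>Take \<open>z\<close> of least modulus in the compact set where
  \<open>b y \<le> a y\<close>, within the closed disc of radius \<open>norm x\<close>. The opposite
  non-strict inequality reaches the circle by continuity and forces equality at
  \<open>z\<close>.\<close>

lemma first_violation:
  fixes a b :: "complex \<Rightarrow> real"
  assumes cont: "continuous_on (ball 0 1) a" "continuous_on (ball 0 1) b"
    and start: "a 0 < b 0" and bad: "x \<in> ball 0 1" "\<not> a x < b x"
  obtains z where "z \<in> ball 0 1" "z \<noteq> 0" "a z = b z" "\<And>y. norm y < norm z \<Longrightarrow> a y < b y"
    "\<And>y. norm y \<le> norm z \<Longrightarrow> a y \<le> b y"
proof -
  define B where "B = {y \<in> cball 0 (norm x). b y \<le> a y}"
  have sub: "cball 0 (norm x) \<subseteq> ball (0::complex) 1" using bad(1) by auto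
  have "closed B" unfolding B_def
    using continuous_on_subset[OF cont(1) sub] continuous_on_subset[OF cont(2) sub]
    by (intro continuous_on_closed_Collect_le) auto
  moreover have "bounded B" unfolding B_def by (rule bounded_subset[OF bounded_cball[of 0 "norm x"]]) auto
  ultimately have "compact B" by (simp add: compact_eq_bounded_closed)
  moreover have "B \<noteq> {}" using bad by (auto simp: B_def not_less)
  ultimately obtain z where z: "z \<in> B" and min: "\<And>y. y \<in> B \<Longrightarrow> norm z \<le> norm y"
    using continuous_attains_inf[of B norm] by (auto intro!: continuous_intros)
  have z1: "z \<in> ball 0 1" using z sub by (auto simp: B_def)
  have lt: "a y < b y" if "norm y < norm z" for y
  proof (rule ccontr)
    assume "\<not> a y < b y"
    then have "y \<in> B" using z that by (auto simp: B_def)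
    from min[OF this] that show False by simp
  qed
  have z0: "z \<noteq> 0" using z start by (auto simp: B_def)
  have le: "a y \<le> b y" if "norm y \<le> norm z" for y
  proof -
    have "y \<in> closure (ball 0 (norm z))" using that z0 by simp
    moreover have sub: "closure (ball 0 (norm z)) \<subseteq> ball (0::complex) 1" using z1 z0 by auto
    have "continuous_on (closure (ball 0 (norm z))) (\<lambda>y. a y - b y)"
      by (intro continuous_on_diff continuous_on_subset[OF cont(1) sub]
          continuous_on_subset[OF cont(2) sub])
    moreover have "a y - b y \<le> 0" if "y \<in> ball 0 (norm z)" for y using lt[of y] that by simp
    ultimately have "a y - b y \<le> 0"
      using continuous_le_on_closure[of "ball 0 (norm z)" "\<lambda>y. a y - b y" y 0] by blast
    then show ?thesis by simp
  qed
  show thesis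
  proof (rule that[OF z1 z0 _ lt le])
    have "b z \<le> a z" using z by (simp add: B_def)
    then show "a z = b z" using le[of z] by simp
  qed
qed

text \<open>The right-hand side is monotone in \<open>s\<close>, with value
  \<open>1 / (2 * \<beta>)\<close> at \<open>s = 0\<close> and limit \<open>\<beta> / 2\<close> at
  infinity. It will bound \<open>- Re P\<close> from below at a point where \<open>Q\<close> is
  imaginary, with \<open>s = (Im Q)\<^sup>2\<close>.\<close>

lemma min_half_bound:
  fixes \<beta> s :: real
  assumes "0 < \<beta>" "0 \<le> s"
  shows "min (\<beta> / 2) (1 / (2 * \<beta>)) \<le> \<beta> * (1 + s) / (2 * (\<beta>\<^sup>2 + s))"
proof (cases "\<beta> \<le> 1")
  case True
  then have "\<beta>\<^sup>2 + s \<le> 1 + s" using assms by (simp add: power_le_one)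
  moreover have "0 < \<beta>\<^sup>2 + s" using assms by (simp add: add_pos_nonneg)
  ultimately have "\<beta> / 2 * 1 \<le> \<beta> / 2 * ((1 + s) / (\<beta>\<^sup>2 + s))"
    using assms by (intro mult_left_mono) auto
  also have "\<dots> = \<beta> * (1 + s) / (2 * (\<beta>\<^sup>2 + s))" by simp
  finally have "\<beta> / 2 \<le> \<beta> * (1 + s) / (2 * (\<beta>\<^sup>2 + s))" by simp
  then show ?thesis by (rule min.coboundedI1)
next
  case False
  then have "1 \<le> \<beta>\<^sup>2" by simp
  then have "\<beta>\<^sup>2 + s \<le> \<beta>\<^sup>2 * (1 + s)" using assms mult_right_mono[of 1 "\<beta>\<^sup>2" s] by (simp add: algebra_simps)
  moreover have "0 < \<beta>\<^sup>2 + s" using assms by (simp add: add_pos_nonneg)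
  ultimately have "1 / (2 * \<beta>) * 1 \<le> 1 / (2 * \<beta>) * (\<beta>\<^sup>2 * (1 + s) / (\<beta>\<^sup>2 + s))"
    using assms by (intro mult_left_mono) auto
  also have "\<dots> = \<beta> * (1 + s) / (2 * (\<beta>\<^sup>2 + s))" using assms by (simp add: power2_eq_square)
  finally have "1 / (2 * \<beta>) \<le> \<beta> * (1 + s) / (2 * (\<beta>\<^sup>2 + s))" by simp
  then show ?thesis by (rule min.coboundedI2)
qed

lemma cmod_one_minus_eq_iff: "cmod (1 - w) = cmod (1 + w) \<longleftrightarrow> Re w = 0"
  unfolding cmod_def real_sqrt_eq_iff by (auto simp: power2_eq_square algebra_simps)

lemma cmod_one_minus_less_iff: "cmod (1 - w) < cmod (1 + w) \<longleftrightarrow> 0 < Re w"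
  unfolding cmod_def real_sqrt_less_iff by (auto simp: power2_eq_square algebra_simps)

text \<open>
  \<open>R = q' / \<Phi>'\<close> is used instead of \<open>Q = \<beta> / R - \<beta>\<close>, which is only meromorphic a priori; with
  \<open>N = R (1 - Q)\<close> and \<open>D = R (1 + Q)\<close>, the claim becomes \<open>norm N < norm D\<close>.
\<close>
lemma Briot_Bouquet_positive:
  fixes \<beta> :: real and P R :: "complex \<Rightarrow> complex"
  assumes \<beta>: "0 < \<beta>" and holo: "R holomorphic_on ball 0 1"
    and ode: "\<And>z. z \<in> ball 0 1 \<Longrightarrow> z * deriv R z + (of_real \<beta> + P z) * R z = of_real \<beta>"
    and R0: "R 0 = of_real (\<beta> / (\<beta> + 1))"
    and P: "\<And>z. z \<in> ball 0 1 \<Longrightarrow> - min (\<beta> / 2) (1 / (2 * \<beta>)) < Re (P z)"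
    and z: "z \<in> ball 0 1"
  shows "R z \<noteq> 0" and "0 < Re (of_real \<beta> / R z - of_real \<beta>)"
proof -
  define N where "N = (\<lambda>z. (1 + of_real \<beta>) * R z - of_real \<beta>)"
  define D where "D = (\<lambda>z. (1 - of_real \<beta>) * R z + of_real \<beta>)"
  have holN: "N holomorphic_on ball 0 1" and holD: "D holomorphic_on ball 0 1"
    unfolding N_def D_def by (intro holomorphic_intros holo)+
  have N0: "N 0 = 0"
  proof -
    have "N 0 = of_real ((1 + \<beta>) * (\<beta> / (\<beta> + 1)) - \<beta>)" by (simp add: N_def R0)
    also have "(1 + \<beta>) * (\<beta> / (\<beta> + 1)) - \<beta> = 0" using \<beta> by (simp add: field_simps)
    finally show ?thesis by simp
  qed
  have D0: "D 0 \<noteq> 0"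
  proof -
    have "D 0 = of_real ((1 - \<beta>) * (\<beta> / (\<beta> + 1)) + \<beta>)" by (simp add: D_def R0)
    also have "(1 - \<beta>) * (\<beta> / (\<beta> + 1)) + \<beta> = 2 * \<beta> / (\<beta> + 1)" using \<beta> by (simp add: field_simps)
    finally show ?thesis using \<beta> by (simp add: of_real_eq_0_iff del: of_real_divide of_real_mult)
  qed
  have quot: "N x = R x * (1 - (of_real \<beta> / R x - of_real \<beta>))"
    "D x = R x * (1 + (of_real \<beta> / R x - of_real \<beta>))" if "R x \<noteq> 0" for x
    using that by (simp_all add: N_def D_def field_simps)
  have main: "norm (N z) < norm (D z)"
  proof (rule ccontr)
    assume neg: "\<not> norm (N z) < norm (D z)"
    have "continuous_on (ball 0 1) (\<lambda>z. norm (N z))" "continuous_on (ball 0 1) (\<lambda>z. norm (D z))"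
      using holN holD by (auto intro!: continuous_on_norm holomorphic_on_imp_continuous_on)
    moreover have "norm (N 0) < norm (D 0)" using N0 D0 by simp
    ultimately obtain x where x: "x \<in> ball 0 1" "x \<noteq> 0" and eq: "norm (N x) = norm (D x)"
      and lt: "\<And>y. norm y < norm x \<Longrightarrow> norm (N y) < norm (D y)"
      and le: "\<And>y. norm y \<le> norm x \<Longrightarrow> norm (N y) \<le> norm (D y)"
      using first_violation[of "\<lambda>z. norm (N z)" "\<lambda>z. norm (D z)" z] z neg by blast
    \<comment> \<open>Since \<open>N + D = 2 * R\<close>, a common zero would be a zero of
      \<open>R\<close>, where \<open>D\<close> equals \<open>\<beta>\<close>.\<close>
    have Dx: "D x \<noteq> 0"
    proof
      assume D: "D x = 0"
      then have "N x = 0" using eq by simp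
      then have "N x + D x = 0" using D by simp
      then have "R x = 0" by (simp add: N_def D_def algebra_simps)
      then show False using D \<beta> by (simp add: D_def)
    qed
    \<comment> \<open>This removes the possible poles of \<open>W = (1 - Q) / (1 + Q)\<close>; none
      lies in \<open>ball 0 (norm x)\<close>, where \<open>norm N < norm D\<close>.\<close>
    define S where "S = {y \<in> ball 0 1. D y \<noteq> 0}"
    have S: "open S" unfolding S_def
      using continuous_open_preimage[OF holomorphic_on_imp_continuous_on[OF holD] open_ball,
          of "- {0}"]
      by (auto simp: vimage_def Int_def Collect_conj_eq[symmetric])
    define W where "W = (\<lambda>y. N y / D y)"
    have holW: "W holomorphic_on S" unfolding W_def
      by (intro holomorphic_intros holomorphic_on_subset[OF holN] holomorphic_on_subset[OF holD])
         (auto simp: S_def)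
    have normW: "norm (W x) = 1" using eq Dx by (simp add: W_def norm_divide)
    obtain k :: real where k: "1 \<le> k" and kW: "x * deriv W x = of_real k * W x"
    proof (rule Jack_lemma[OF holW S, of "norm x" x])
      show "ball 0 (norm x) \<subseteq> S" using lt x by (force simp: S_def)
      show "x \<in> S" using x Dx by (simp add: S_def)
      show "W x \<noteq> 0" using normW by auto
      show "norm (W y) \<le> norm (W x)" if "y \<in> S" "norm y \<le> norm x" for y
        using le[OF that(2)] that(1) unfolding normW by (simp add: W_def S_def norm_divide)
    qed (use x N0 in \<open>auto simp: W_def\<close>)
    have dR: "(R has_field_derivative deriv R x) (at x)"
      using holo x by (auto intro: holomorphic_derivI)
    have "(W has_field_derivative 2 * of_real \<beta> * deriv R x / (D x)\<^sup>2) (at x)"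
    proof -
      have "((\<lambda>y. N y / D y) has_field_derivative
          ((1 + of_real \<beta>) * deriv R x * D x - N x * ((1 - of_real \<beta>) * deriv R x)) / (D x * D x)) (at x)"
        using dR Dx unfolding N_def D_def by (auto intro!: derivative_eq_intros)
      moreover have "(1 + of_real \<beta>) * deriv R x * D x - N x * ((1 - of_real \<beta>) * deriv R x)
          = 2 * of_real \<beta> * deriv R x"
        by (simp add: N_def D_def algebra_simps)
      ultimately show ?thesis by (simp add: W_def power2_eq_square)
    qed
    then have "deriv W x = 2 * of_real \<beta> * deriv R x / (D x)\<^sup>2" by (rule DERIV_imp_deriv)
    \<comment> \<open>Jack's relation \<open>x * W' = k * W\<close> with denominators cleared, so
      that it also covers a zero of \<open>R\<close>.\<close>
    have step: "2 * of_real \<beta> * (x * deriv R x) = of_real k * (N x * D x)"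
    proof -
      have "2 * of_real \<beta> * (x * deriv R x) = x * deriv W x * (D x)\<^sup>2"
        using Dx \<open>deriv W x = _\<close> by (simp add: mult_ac)
      also have "\<dots> = of_real k * (N x * D x)"
        unfolding kW using Dx by (simp add: W_def power2_eq_square)
      finally show ?thesis .
    qed
    show False
    proof (cases "R x = 0")
      \<comment> \<open>A zero of \<open>R\<close> is a pole of \<open>Q\<close>. There
        \<open>N = - \<beta>\<close>, \<open>D = \<beta>\<close> and the differential equation gives
        \<open>x * R' = \<beta>\<close>, so the two sides of \<open>step\<close> have opposite
        signs.\<close>
      case True
      then have "x * deriv R x = of_real \<beta>" using ode[OF x(1)] by simp
      with step True have "of_real (2 * \<beta> * \<beta>) = (of_real (- (k * (\<beta> * \<beta>))) :: complex)"
        by (simp add: N_def D_def)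
      then have "2 * \<beta> * \<beta> = - (k * (\<beta> * \<beta>))" unfolding of_real_eq_iff .
      then have "(2 + k) * (\<beta> * \<beta>) = 0" by (simp add: algebra_simps)
      then show False using \<beta> k by simp
    next
      case False
      define Q where "Q = of_real \<beta> / R x - of_real \<beta>"
      have N: "N x = R x * (1 - Q)" and D: "D x = R x * (1 + Q)"
        using quot[OF False] by (simp_all add: Q_def)
      have "norm (1 - Q) = norm (1 + Q)" using eq False unfolding N D norm_mult by simp
      then have "Re Q = 0" unfolding cmod_one_minus_eq_iff .
      then obtain \<rho> where Q: "Q = \<i> * of_real \<rho>" by (auto simp: complex_eq_iff)
      have Qb: "Q + of_real \<beta> = of_real \<beta> / R x" by (simp add: Q_def)
      have Qb0: "Q + of_real \<beta> \<noteq> 0" unfolding Qb using False \<beta> by simp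
      have R: "R x = of_real \<beta> / (Q + of_real \<beta>)" unfolding Qb using False \<beta> by simp
      \<comment> \<open>Jack's relation amounts to
        \<open>x * Q' = - k * (1 - Q\<^sup>2) / 2\<close>, which is inserted into
        \<open>P = Q + x * Q' / (Q + \<beta>)\<close>, the equation for \<open>R\<close> in terms of
        \<open>Q\<close>.\<close>
      have PQ: "P x = Q - of_real k * (1 - Q\<^sup>2) / (2 * (Q + of_real \<beta>))"
      proof -
        have "2 * of_real \<beta> * (of_real \<beta> - (of_real \<beta> + P x) * R x) = of_real k * (R x * (1 - Q) * (R x * (1 + Q)))"
        proof -
          have "x * deriv R x = of_real \<beta> - (of_real \<beta> + P x) * R x"
            using ode[OF x(1)] by (simp add: eq_diff_eq)
          with step show ?thesis unfolding N D by simp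
        qed
        then have "2 * of_real \<beta> * ((Q + of_real \<beta>) - (of_real \<beta> + P x)) * R x
            = of_real k * (1 - Q\<^sup>2) * R x * R x"
          unfolding Qb using False by (simp add: algebra_simps power2_eq_square)
        then have "2 * of_real \<beta> * (Q - P x) = of_real k * (1 - Q\<^sup>2) * R x"
          using False by simp
        moreover have "2 * B * (Y / (2 * T)) = Y * (B / T)" for B Y T :: complex by simp
        ultimately have "2 * of_real \<beta> * (Q - P x)
            = 2 * of_real \<beta> * (of_real k * (1 - Q\<^sup>2) / (2 * (Q + of_real \<beta>)))"
          unfolding R by metis
        then have "Q - P x = of_real k * (1 - Q\<^sup>2) / (2 * (Q + of_real \<beta>))"
          using \<beta> by (subst (asm) mult_left_cancel) auto
        then show ?thesis by (simp add: algebra_simps)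
      qed
      have "Re (P x) = - (k * (\<beta> * (1 + \<rho>\<^sup>2) / (2 * (\<beta>\<^sup>2 + \<rho>\<^sup>2))))"
      proof -
        have "1 - Q\<^sup>2 = of_real (1 + \<rho>\<^sup>2)" unfolding Q by (simp add: power_mult_distrib)
        then have "P x = Q - of_real (k * (1 + \<rho>\<^sup>2) / 2) / (Q + of_real \<beta>)" unfolding PQ by simp
        moreover have "Re (of_real A / (Q + of_real \<beta>)) = A * \<beta> / (\<beta>\<^sup>2 + \<rho>\<^sup>2)" for A :: real
          unfolding Q by (simp add: Re_divide power2_eq_square)
        ultimately have "Re (P x) = - (k * (1 + \<rho>\<^sup>2) / 2 * \<beta> / (\<beta>\<^sup>2 + \<rho>\<^sup>2))"
          using \<open>Re Q = 0\<close> by (simp only: minus_complex.sel)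
        then show ?thesis by (simp add: field_simps)
      qed
      moreover have "min (\<beta> / 2) (1 / (2 * \<beta>)) \<le> k * (\<beta> * (1 + \<rho>\<^sup>2) / (2 * (\<beta>\<^sup>2 + \<rho>\<^sup>2)))"
        using min_half_bound[OF \<beta>, of "\<rho>\<^sup>2"] mult_right_mono[OF k, of "\<beta> * (1 + \<rho>\<^sup>2) / (2 * (\<beta>\<^sup>2 + \<rho>\<^sup>2))"] \<beta>
        by simp
      ultimately show False using P[OF x(1)] by simp
    qed
  qed
  show R: "R z \<noteq> 0"
  proof
    assume "R z = 0"
    then show False using main by (simp add: N_def D_def)
  qed
  show "0 < Re (of_real \<beta> / R z - of_real \<beta>)"
    using main R unfolding quot[OF R] norm_mult cmod_one_minus_less_iff[symmetric] by simp
qed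


subsection \<open>Convex univalent functions\<close>

text \<open>The analytic form of convexity: the tangent to the image of each circle about 0 turns
  monotonically. Univalence is derived from it below.\<close>

locale convex_map =
  fixes q :: "complex \<Rightarrow> complex"
  assumes holo: "q holomorphic_on ball 0 1"
    and nz: "z \<in> ball 0 1 \<Longrightarrow> deriv q z \<noteq> 0"
    and pos: "z \<in> ball 0 1 \<Longrightarrow> 0 < Re (1 + z * deriv (deriv q) z / deriv q z)"
begin

lemma holo_deriv: "deriv q holomorphic_on ball 0 1"
  using holo by (rule holomorphic_deriv) simp

lemma DERIV_q: "z \<in> ball 0 1 \<Longrightarrow> (q has_field_derivative deriv q z) (at z)"
  using holo by (rule holomorphic_derivI) simp

lemma DERIV_deriv_q:
  "z \<in> ball 0 1 \<Longrightarrow> (deriv q has_field_derivative deriv (deriv q) z) (at z)"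
  using holo_deriv by (rule holomorphic_derivI) simp

text \<open>
  Along a circle the argument of the tangent to the image curve increases, by \<open>2 * pi\<close> in total.
  Hence the distance of the curve to the tangent line at \<open>q \<zeta>\<close> first increases and then decreases.
\<close>
lemma support_on_circle:
  assumes \<zeta>: "\<zeta> \<in> ball 0 1" and eq: "norm \<omega> = norm \<zeta>" and ne: "\<omega> \<noteq> \<zeta>"
  shows "0 < Re (cnj (\<zeta> * deriv q \<zeta>) * (q \<zeta> - q \<omega>))"
proof -
  have \<zeta>0: "\<zeta> \<noteq> 0" using eq ne by auto
  \<comment> \<open>On the contractible disc the zero-free \<open>deriv q\<close> has a holomorphic
    logarithm \<open>l\<close>, so \<open>Im (l z)\<close> is a continuous argument of it.\<close>
  obtain l where hol: "l holomorphic_on ball 0 1"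
    and l: "\<And>z. z \<in> ball 0 1 \<Longrightarrow> deriv q z = exp (l z)"
    using contractible_imp_holomorphic_log[OF holo_deriv convex_imp_contractible[OF convex_ball] nz]
    by blast
  have dl: "(l has_field_derivative deriv (deriv q) z / deriv q z) (at z)" if z: "z \<in> ball 0 1" for z
  proof -
    have d: "(l has_field_derivative deriv l z) (at z)"
      using hol open_ball z by (rule holomorphic_derivI)
    have "((\<lambda>z. exp (l z)) has_field_derivative exp (l z) * deriv l z) (at z)"
      using d by (auto intro!: derivative_eq_intros)
    moreover have "((\<lambda>z. exp (l z)) has_field_derivative deriv (deriv q) z) (at z)"
      using DERIV_deriv_q[OF z] open_ball z
      by (rule has_field_derivative_transform_within_open) (rule l)
    ultimately have "exp (l z) * deriv l z = deriv (deriv q) z" by (rule DERIV_unique)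
    then have "deriv l z = deriv (deriv q) z / deriv q z" using l[OF z] nz[OF z] by (simp add: field_simps)
    then show ?thesis using d by simp
  qed
  define e where "e = (\<lambda>t::real. \<zeta> * exp (\<i> * of_real t))"
  have e: "e t \<in> ball 0 1" for t using \<zeta> by (simp add: e_def norm_mult)
  have de: "(e has_vector_derivative \<i> * e t) (at t)" for t
  proof -
    have "((\<lambda>t. \<zeta> * exp (\<i> * t)) has_field_derivative \<i> * e t) (at (of_real t))"
      unfolding e_def by (auto intro!: derivative_eq_intros)
    from has_vector_derivative_real_field[OF this] show ?thesis by (simp add: e_def)
  qed
  \<comment> \<open>\<open>\<phi> t\<close> is the angle through which the normal
    \<open>z * deriv q z\<close> has turned between \<open>\<zeta>\<close> and \<open>e t\<close>.
    Its derivative is the positive quantity in \<open>pos\<close>, and one full turn adds exactly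
    \<open>2 * pi\<close> because \<open>l\<close> is single-valued.\<close>
  define \<phi> where "\<phi> = (\<lambda>t. t + Im (l (e t)) - Im (l \<zeta>))"
  have d\<phi>: "(\<phi> has_real_derivative Re (1 + e t * deriv (deriv q) (e t) / deriv q (e t))) (at t)" for t
  proof -
    have "(l \<circ> e has_vector_derivative \<i> * e t * (deriv (deriv q) (e t) / deriv q (e t))) (at t)"
      using de dl[OF e] by (rule field_vector_diff_chain_at)
    then have "((\<lambda>t. Im (l (e t))) has_real_derivative Im (\<i> * e t * (deriv (deriv q) (e t) / deriv q (e t)))) (at t)"
      unfolding o_def by (rule has_field_derivative_Im)
    then have "(\<phi> has_real_derivative
        1 + Im (\<i> * e t * (deriv (deriv q) (e t) / deriv q (e t))) - 0) (at t)"
      unfolding \<phi>_def by (intro DERIV_add DERIV_diff DERIV_ident DERIV_const)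
    moreover have "\<i> * e t * (deriv (deriv q) (e t) / deriv q (e t))
        = \<i> * (e t * deriv (deriv q) (e t) / deriv q (e t))" by simp
    ultimately show ?thesis by (simp only: Im_i_times plus_complex.sel one_complex.sel diff_0_right)
  qed
  have incr: "\<phi> s < \<phi> t" if "s < t" for s t
    using d\<phi> pos[OF e] by (intro DERIV_pos_imp_increasing[OF that]) blast
  have e_ends: "e 0 = \<zeta>" "e (2 * pi) = \<zeta>" using exp_two_pi_i by (simp_all add: e_def mult_ac)
  have \<phi>_ends: "\<phi> 0 = 0" "\<phi> (2 * pi) = 2 * pi" by (simp_all add: \<phi>_def e_ends)
  \<comment> \<open>\<open>n\<close> is the outward normal to the image curve at
    \<open>q \<zeta>\<close>, and \<open>h t\<close> is \<open>norm n\<close> times the signed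
    distance of \<open>q (e t)\<close> from the tangent line there, counted inwards.\<close>
  define n where "n = \<zeta> * deriv q \<zeta>"
  define h where "h = (\<lambda>t. Re (cnj n * (q \<zeta> - q (e t))))"
  have dh: "(h has_real_derivative Im (cnj n * (e t * deriv q (e t)))) (at t)" for t
  proof -
    have "(q \<circ> e has_vector_derivative \<i> * e t * deriv q (e t)) (at t)"
      using de DERIV_q[OF e] by (rule field_vector_diff_chain_at)
    then have "((\<lambda>t. cnj n * (q \<zeta> - q (e t))) has_vector_derivative cnj n * (0 - \<i> * e t * deriv q (e t))) (at t)"
      unfolding o_def
      by (intro has_vector_derivative_mult_right has_vector_derivative_diff has_vector_derivative_const)
    then have "(h has_real_derivative Re (cnj n * (0 - \<i> * e t * deriv q (e t)))) (at t)"
      unfolding h_def by (rule has_field_derivative_Re)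
    moreover have "cnj n * (0 - \<i> * e t * deriv q (e t)) = - (\<i> * (cnj n * (e t * deriv q (e t))))" by simp
    ultimately show ?thesis by (simp only: uminus_complex.sel Re_i_times minus_minus)
  qed
  \<comment> \<open>The factor \<open>cnj n\<close> cancels the argument of the initial normal, so
    only the turning angle enters the sine.\<close>
  have tangent: "\<exists>m>0. Im (cnj n * (e t * deriv q (e t))) = m * sin (\<phi> t)" for t
  proof -
    have "cnj n * (e t * deriv q (e t)) = cnj \<zeta> * \<zeta> * (exp (cnj (l \<zeta>)) * exp (\<i> * of_real t) * exp (l (e t)))"
      unfolding n_def by (simp add: l[OF \<zeta>] l[OF e] exp_cnj) (simp add: e_def)
    also have "\<dots> = of_real ((cmod \<zeta>)\<^sup>2) * exp (cnj (l \<zeta>) + \<i> * of_real t + l (e t))"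
      by (simp only: exp_add complex_norm_square mult_ac)
    finally have "Im (cnj n * (e t * deriv q (e t)))
        = (cmod \<zeta>)\<^sup>2 * exp (Re (l \<zeta>) + Re (l (e t))) * sin (\<phi> t)"
      by (simp add: Im_exp \<phi>_def algebra_simps)
    moreover have "0 < (cmod \<zeta>)\<^sup>2 * exp (Re (l \<zeta>) + Re (l (e t)))" using \<zeta>0 by simp
    ultimately show ?thesis by blast
  qed
  define \<theta> where "\<theta> = Arg2pi (\<omega> / \<zeta>)"
  have "\<omega> / \<zeta> = of_real (norm (\<omega> / \<zeta>)) * exp (\<i> * of_real \<theta>)"
    unfolding \<theta>_def by (rule Arg2pi_eq)
  then have \<omega>: "\<omega> = e \<theta>" using \<zeta>0 eq by (simp add: norm_divide e_def field_simps)
  have \<theta>: "0 < \<theta>" "\<theta> < 2 * pi"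
  proof -
    have "\<theta> \<noteq> 0" using \<omega> ne by (auto simp: e_def)
    then show "0 < \<theta>" "\<theta> < 2 * pi"
      using Arg2pi_ge_0[of "\<omega> / \<zeta>"] Arg2pi_lt_2pi[of "\<omega> / \<zeta>"] by (simp_all add: \<theta>_def)
  qed
  have h_ends: "h 0 = 0" "h (2 * pi) = 0" by (simp_all add: h_def e_ends)
  have cont: "continuous_on A h" for A
    using dh by (meson DERIV_atLeastAtMost_imp_continuous_on DERIV_isCont continuous_at_imp_continuous_on)
  have "0 < h \<theta>"
  \<comment> \<open>The sine is positive as long as \<open>\<phi> < pi\<close> and negative
    afterwards, so \<open>h\<close> is compared with its zero at 0 in the first case and with its
    zero at \<open>2 * pi\<close> in the second.\<close>
  proof (cases "\<phi> \<theta> \<le> pi")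
    case True
    have "h 0 < h \<theta>"
    proof (rule DERIV_pos_imp_increasing_open[OF \<theta>(1) _ cont])
      fix t assume t: "0 < t" "t < \<theta>"
      then have "0 < \<phi> t" "\<phi> t < pi" using incr[of 0 t] incr[of t \<theta>] True \<phi>_ends by auto
      then have "0 < sin (\<phi> t)" by (rule sin_gt_zero)
      then show "\<exists>y. DERIV h t :> y \<and> 0 < y"
        using dh[of t] tangent[of t] by (metis mult_pos_pos)
    qed
    then show ?thesis by (simp add: h_ends)
  next
    case False
    have "h (2 * pi) < h \<theta>"
    proof (rule DERIV_neg_imp_decreasing_open[OF \<theta>(2) _ cont])
      fix t assume t: "\<theta> < t" "t < 2 * pi"
      then have "pi < \<phi> t" "\<phi> t < 2 * pi" using incr[of \<theta> t] incr[of t "2 * pi"] False \<phi>_ends by auto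
      then have "sin (\<phi> t) < 0" by (rule sin_lt_zero)
      then show "\<exists>y. DERIV h t :> y \<and> y < 0"
        using dh[of t] tangent[of t] by (metis mult_pos_neg)
    qed
    then show ?thesis by (simp add: h_ends)
  qed
  then show ?thesis by (simp add: h_def n_def \<omega>)
qed

text \<open>The maximum principle for \<open>Re (cnj n * q)\<close> carries the inequality from the
  circle into the disc.\<close>

lemma support:
  assumes \<zeta>: "\<zeta> \<in> ball 0 1" and le: "norm \<omega> \<le> norm \<zeta>" and ne: "\<omega> \<noteq> \<zeta>"
  shows "0 < Re (cnj (\<zeta> * deriv q \<zeta>) * (q \<zeta> - q \<omega>))"
proof (cases "norm \<omega> = norm \<zeta>")
  case True
  then show ?thesis using support_on_circle \<zeta> ne by blast
next
  case False
  define r where "r = norm \<zeta>"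
  define n where "n = \<zeta> * deriv q \<zeta>"
  have \<omega>: "\<omega> \<in> ball 0 r" and r: "0 < r" "r < 1"
    using False le \<zeta> norm_ge_zero[of \<omega>] by (auto simp: r_def simp del: norm_ge_zero)
  have n0: "n \<noteq> 0" using r nz[OF \<zeta>] by (auto simp: n_def r_def)
  define f where "f = (\<lambda>z. cnj n * q z)"
  have sub: "cball 0 r \<subseteq> ball (0::complex) 1" using r by auto
  have holf: "f holomorphic_on ball 0 1" unfolding f_def by (intro holomorphic_intros holo)
  have le: "Re (f z) \<le> Re (f \<zeta>)" if z: "z \<in> ball 0 r" for z
  proof (rule maximum_real_frontier[of f "cball 0 r"])
    show "f holomorphic_on interior (cball 0 r)"
      using sub interior_subset[of "cball 0 r"] by (intro holomorphic_on_subset[OF holf]) blast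
    show "continuous_on (closure (cball 0 r)) f"
      using sub holf by (auto intro: holomorphic_on_imp_continuous_on holomorphic_on_subset)
    show "Re (f y) \<le> Re (f \<zeta>)" if "y \<in> frontier (cball 0 r)" for y
    proof (cases "y = \<zeta>")
      case False
      then have "0 < Re (cnj n * (q \<zeta> - q y))" unfolding n_def
        using that r by (intro support_on_circle \<zeta>) (auto simp: r_def)
      then show ?thesis by (simp add: f_def algebra_simps)
    qed simp
    show "z \<in> cball 0 r" using z by simp
  qed simp
  have "Re (f \<omega>) \<noteq> Re (f \<zeta>)"
  proof
    assume eq: "Re (f \<omega>) = Re (f \<zeta>)"
    \<comment> \<open>Equality at the interior point \<open>\<omega>\<close> would be a maximum of
      \<open>norm (exp (f z))\<close>. Then \<open>exp (f z)\<close> would be constant, although its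
      derivative at 0 is a product of nonzero factors.\<close>
    have "(\<lambda>z. exp (f z)) constant_on ball 0 r"
    proof (rule maximum_modulus_principle)
      show "(\<lambda>z. exp (f z)) holomorphic_on ball 0 r"
        using r by (intro holomorphic_intros holomorphic_on_subset[OF holf]) auto
      show "norm (exp (f z)) \<le> norm (exp (f \<omega>))" if "z \<in> ball 0 r" for z
        using le[OF that] eq by simp
    qed (use \<omega> in auto)
    then obtain c where c: "\<And>z. z \<in> ball 0 r \<Longrightarrow> exp (f z) = c" unfolding constant_on_def by blast
    have "((\<lambda>z. exp (f z)) has_field_derivative exp (f 0) * (cnj n * deriv q 0)) (at 0)"
      unfolding f_def using DERIV_q[of 0] by (auto intro!: derivative_eq_intros)
    moreover have "((\<lambda>z. exp (f z)) has_field_derivative 0) (at 0)"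
      using r c by (intro has_field_derivative_transform_within_open[OF DERIV_const[of c] open_ball[of 0 r]]) auto
    ultimately have "exp (f 0) * (cnj n * deriv q 0) = 0" by (rule DERIV_unique)
    then show False using n0 nz[of 0] by simp
  qed
  then have "Re (f \<omega>) < Re (f \<zeta>)" using le[OF \<omega>] by simp
  then show ?thesis by (simp add: f_def n_def algebra_simps)
qed

text \<open>With the point of larger modulus as \<open>\<zeta>\<close> in \<open>support\<close>,
  equal values of \<open>q\<close> would give \<open>0 < 0\<close>.\<close>

lemma inj: "inj_on q (ball 0 1)"
proof (rule inj_onI, rule ccontr)
  fix x y assume xy: "x \<in> ball 0 1" "y \<in> ball 0 1" "q x = q y" "x \<noteq> y"
  then show False
    using support[of x y] support[of y x] by (cases "norm y \<le> norm x") auto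
qed

lemma univalent: "univalent q"
  using holo inj by (simp add: univalent_def)

text \<open>
  The support inequality gives the claim for \<open>norm a = norm b\<close>; the maximum principle for the
  quotient of the two difference quotients extends it to the disc.
\<close>
lemma monotone:
  assumes a: "a \<in> ball 0 1" and b: "b \<in> ball 0 1"
  shows "0 \<le> Re ((a * deriv q a - b * deriv q b) * cnj (q a - q b))"
proof -
  have main: "0 \<le> Re ((a * deriv q a - b * deriv q b) * cnj (q a - q b))"
    if b: "b \<in> ball 0 1" and lt: "norm a < norm b" for a b
  proof -
    define v where "v = (\<lambda>z. z * deriv q z)"
    have holv: "v holomorphic_on ball 0 1" unfolding v_def by (intro holomorphic_intros holo_deriv)
    \<comment> \<open>Filling the removable singularity at \<open>b\<close> makes
      \<open>dv / dq\<close> holomorphic, as \<open>dq\<close> is zero-free by injectivity and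
      \<open>nz\<close>. The minus sign in \<open>F\<close> below turns the desired lower bound into
      the upper bound that the maximum principle provides.\<close>
    define dq where "dq = (\<lambda>z. if z = b then deriv q b else (q z - q b) / (z - b))"
    define dv where "dv = (\<lambda>z. if z = b then deriv v b else (v z - v b) / (z - b))"
    have hol: "dq holomorphic_on ball 0 1" "dv holomorphic_on ball 0 1"
      unfolding dq_def dv_def by (intro pole_lemma_open holo holv open_ball)+
    have dq0: "dq z \<noteq> 0" if "z \<in> ball 0 1" for z
      using that b nz[OF b] inj_onD[OF inj, of z b] by (auto simp: dq_def)
    define F where "F = (\<lambda>z. - (dv z / dq z))"
    have holF: "F holomorphic_on ball 0 1" unfolding F_def using dq0
      by (intro holomorphic_intros hol) auto
    have sub: "cball 0 (norm b) \<subseteq> ball (0::complex) 1" using b by auto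
    have F: "Re ((v z - v b) * cnj (q z - q b)) = - Re (F z) * (norm (q z - q b))\<^sup>2"
      if "z \<noteq> b" "z \<in> ball 0 1" for z
    proof -
      have "q z - q b \<noteq> 0" using dq0[OF that(2)] that(1) by (auto simp: dq_def)
      moreover have "F z = - ((v z - v b) / (q z - q b))" using that by (simp add: F_def dq_def dv_def)
      ultimately have "(v z - v b) * cnj (q z - q b) = - F z * of_real ((norm (q z - q b))\<^sup>2)"
        by (simp add: complex_norm_square del: of_real_power)
      then show ?thesis by (simp del: of_real_power)
    qed
    have "Re (F a) \<le> 0"
    proof (rule maximum_real_frontier[of F "cball 0 (norm b)"])
      show "F holomorphic_on interior (cball 0 (norm b))"
        using sub interior_subset[of "cball 0 (norm b)"] by (intro holomorphic_on_subset[OF holF]) blast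
      show "continuous_on (closure (cball 0 (norm b))) F"
        using sub holF by (auto intro: holomorphic_on_imp_continuous_on holomorphic_on_subset)
      show "Re (F z) \<le> 0" if "z \<in> frontier (cball 0 (norm b))" for z
      proof (cases "z = b")
        case True
        have "(v has_field_derivative deriv q b + b * deriv (deriv q) b) (at b)"
          unfolding v_def using DERIV_deriv_q[OF b] by (auto intro!: derivative_eq_intros)
        then have "F b = - (1 + b * deriv (deriv q) b / deriv q b)"
          using nz[OF b] by (simp add: F_def dq_def dv_def DERIV_imp_deriv add_divide_distrib)
        then show ?thesis using pos[OF b] True by simp
      next
        case False
        have nb: "norm b = norm z" using that lt by auto
        then have z: "z \<in> ball 0 1" using b by simp
        \<comment> \<open>The sum of the two support inequalities is
          \<open>0 < Re ((v z - v b) * cnj (q z - q b))\<close>.\<close>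
        have "0 < Re (cnj (v z) * (q z - q b))" "0 < Re (cnj (v b) * (q b - q z))"
          unfolding v_def by (intro support_on_circle z b; use False nb in simp)+
        then have "0 < - Re (F z) * (norm (q z - q b))\<^sup>2"
          unfolding F[OF False z, symmetric] by (simp add: algebra_simps)
        then show ?thesis by (simp add: zero_less_mult_iff mult_less_0_iff)
      qed
      show "a \<in> cball 0 (norm b)" using lt by simp
    qed simp
    moreover have "a \<noteq> b" "a \<in> ball 0 1" using lt b by auto
    ultimately show ?thesis unfolding F[unfolded v_def, OF \<open>a \<noteq> b\<close> \<open>a \<in> ball 0 1\<close>]
      by (simp add: mult_nonpos_nonneg)
  qed
  consider "norm a < norm b" | "norm b < norm a" | "norm a = norm b" "a = b" | "norm a = norm b" "a \<noteq> b"
    by linarith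
  then show ?thesis
  proof cases
    case 1 then show ?thesis using main[OF b] by simp
  next
    case 2
    have "0 \<le> Re ((b * deriv q b - a * deriv q a) * cnj (q b - q a))" using main[OF a 2] .
    then show ?thesis by (simp add: algebra_simps)
  next
    case 4
    have "0 < Re (cnj (a * deriv q a) * (q a - q b))" "0 < Re (cnj (b * deriv q b) * (q b - q a))"
      by (intro support_on_circle a b; use 4 in simp)+
    then show ?thesis by (simp add: algebra_simps)
  qed simp
qed

text \<open>
  A substitute for Loewner theory: the maps \<open>q + t * (z * deriv q z)\<close> form a subordination chain
  in \<open>t\<close>. The case \<open>s = t\<close> is their injectivity.
\<close>
lemma chain_disjoint:
  fixes s t :: real
  assumes a: "a \<in> ball 0 1" and b: "b \<in> ball 0 1" and st: "0 \<le> s" "s \<le> t"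
    and le: "s = t \<or> norm a \<le> norm b"
    and eq: "q a + of_real s * (a * deriv q a) = q b + of_real t * (b * deriv q b)"
  shows "a = b"
proof (rule ccontr)
  assume ne: "a \<noteq> b"
  define d where "d = q b - q a"
  have d0: "d \<noteq> 0" using inj_onD[OF inj, of a b] a b ne by (auto simp: d_def)
  \<comment> \<open>Split \<open>t\<close> as \<open>s + (t - s)\<close> and pair with
    \<open>cnj d\<close>. The three terms are then positive since \<open>d \<noteq> 0\<close>,
    nonnegative by \<open>monotone\<close>, and nonnegative by \<open>support\<close>, so their sum
    is not 0.\<close>
  have "d + of_real s * (b * deriv q b - a * deriv q a) + of_real (t - s) * (b * deriv q b) = 0"
    using eq by (simp add: d_def algebra_simps)
  then have "0 = Re ((d + of_real s * (b * deriv q b - a * deriv q a)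
      + of_real (t - s) * (b * deriv q b)) * cnj d)" by simp
  also have "\<dots> = (norm d)\<^sup>2 + s * Re ((b * deriv q b - a * deriv q a) * cnj d)
      + (t - s) * Re ((b * deriv q b) * cnj d)"
    unfolding cmod_power2 by (simp add: algebra_simps power2_eq_square)
  finally have sum: "0 = \<dots>" .
  have "0 \<le> s * Re ((b * deriv q b - a * deriv q a) * cnj d)"
    using monotone[OF b a] st unfolding d_def by (intro mult_nonneg_nonneg) auto
  moreover have "0 \<le> (t - s) * Re ((b * deriv q b) * cnj d)"
  proof (cases "s = t")
    case False
    then have "0 < Re (cnj (b * deriv q b) * (q b - q a))" using support b le ne by blast
    then have "0 \<le> Re ((b * deriv q b) * cnj d)" by (simp add: d_def algebra_simps)
    then show ?thesis using st by (intro mult_nonneg_nonneg) auto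
  qed simp
  moreover have "0 < (norm d)\<^sup>2" using d0 by simp
  ultimately show False using sum by linarith
qed

section \<open>Solutions of the differential subordination\<close>

text \<open>The subordinating function is \<open>w = q\<^sup>-\<^sup>1(P)\<close>. Where
  \<open>norm w\<close> is largest on a closed disc, Jack's lemma makes the differential expression
  a value of the chain at parameter \<open>\<delta> * k \<ge> \<delta>\<close>, and
  \<open>chain_disjoint\<close> then bounds \<open>norm w\<close>.\<close>

lemma subordinate_of_Briot_Bouquet:
  fixes \<delta> :: real
  assumes \<delta>: "0 \<le> \<delta>" and holP: "P holomorphic_on ball 0 1"
    and \<Phi>: "\<And>z. z \<in> ball 0 1 \<Longrightarrow> \<Phi> z = q z + of_real \<delta> * (z * deriv q z)"
    and sub: "subordinate (\<lambda>z. P z + of_real \<delta> * (z * deriv P z)) \<Phi>"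
  shows "subordinate P q"
proof -
  obtain \<omega> where \<omega>: "\<And>z. z \<in> ball 0 1 \<Longrightarrow> norm (\<omega> z) \<le> norm z"
    "\<And>z. z \<in> ball 0 1 \<Longrightarrow> P z + of_real \<delta> * (z * deriv P z) = \<Phi> (\<omega> z)"
    using sub unfolding subordinate_def by blast
  have P0: "P 0 = q 0" using \<omega>[of 0] \<Phi>[of 0] by simp
  obtain g where holg: "g holomorphic_on q ` ball 0 1"
    and g: "\<And>z. z \<in> ball 0 1 \<Longrightarrow> g (q z) = z"
    using holomorphic_has_inverse[OF holo open_ball inj] by metis
  \<comment> \<open>The inverse of \<open>q\<close> lives on the image of \<open>q\<close>, so
    \<open>w\<close> is first studied on \<open>U\<close>; that \<open>U\<close> is the whole disc
    follows from \<open>bound\<close>.\<close>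
  define U where "U = {z \<in> ball 0 1. P z \<in> q ` ball 0 1}"
  have "open (q ` ball 0 1)" using open_mapping_thm3[OF holo open_ball inj] .
  then have opU: "open U"
    using continuous_open_preimage[OF holomorphic_on_imp_continuous_on[OF holP] open_ball]
    by (auto simp: U_def vimage_def Int_def Collect_conj_eq[symmetric])
  have sU: "U \<subseteq> ball 0 1" by (auto simp: U_def)
  define w where "w = (\<lambda>z. g (P z))"
  have holw: "w holomorphic_on U" unfolding w_def
    by (rule holomorphic_on_compose_gen[OF holomorphic_on_subset[OF holP sU] holg, unfolded o_def])
       (auto simp: U_def)
  have w1: "w z \<in> ball 0 1" and qw: "q (w z) = P z" if "z \<in> U" for z
    using that g by (auto simp: U_def w_def)
  have w0: "w 0 = 0" using P0 g[of 0] by (simp add: w_def)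
  have bound: "norm (w z) \<le> r" if cU: "cball 0 r \<subseteq> U" and z: "norm z \<le> r" for z r
  proof (cases "r = 0")
    case True
    then show ?thesis using z w0 by simp
  next
    case False
    then have r: "0 < r" using z norm_ge_zero[of z] by (auto simp del: norm_ge_zero)
    have "continuous_on (cball 0 r) (\<lambda>y. norm (w y))"
      using cU holw by (intro continuous_on_norm holomorphic_on_imp_continuous_on)
        (rule holomorphic_on_subset)
    then obtain y where y: "y \<in> cball 0 r" and max: "\<And>x. x \<in> cball 0 r \<Longrightarrow> norm (w x) \<le> norm (w y)"
      using continuous_attains_sup[of "cball 0 r" "\<lambda>y. norm (w y)"] r by auto
    have "norm (w y) \<le> r"
    proof (cases "w y = 0")
      case True
      then show ?thesis using r by simp
    next
      case wy: False
      \<comment> \<open>A maximum in the open disc is excluded by the Schwarz lemma, with its factor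
        \<open>norm y / r < 1\<close>.\<close>
      have yr: "norm y = r"
      proof (rule ccontr)
        assume "norm y \<noteq> r"
        then have lt: "norm y < r" using y by simp
        have "norm (w y) \<le> norm (w y) * (norm y / r)"
        proof (rule Schwarz_ball_le[of w r, OF _ r w0])
          show "w holomorphic_on ball 0 r" using holw cU
            by (rule holomorphic_on_subset[OF _ order_trans[OF ball_subset_cball]])
        qed (use max lt in auto)
        moreover have "norm (w y) * (norm y / r) < norm (w y) * 1"
          using lt r wy by (intro mult_strict_left_mono) auto
        ultimately show False by simp
      qed
      have yU: "y \<in> U" using y cU by auto
      have y1: "y \<in> ball 0 1" using yU sU by auto
      obtain k :: real where k: "1 \<le> k" and kw: "y * deriv w y = of_real k * w y"
      proof (rule Jack_lemma[OF holw opU _ yU yr _ w0 wy])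
        show "ball 0 r \<subseteq> U" using cU by auto
        show "y \<noteq> 0" using yr r by auto
        show "norm (w x) \<le> norm (w y)" if "x \<in> U" "norm x \<le> r" for x using max that by simp
      qed
      have "(w has_field_derivative deriv w y) (at y)" using holw opU yU by (rule holomorphic_derivI)
      then have "((\<lambda>x. q (w x)) has_field_derivative deriv q (w y) * deriv w y) (at y)"
        using DERIV_q[OF w1[OF yU]] by (rule DERIV_chain2[rotated])
      then have "(P has_field_derivative deriv q (w y) * deriv w y) (at y)"
        using opU yU qw by (rule has_field_derivative_transform_within_open)
      then have "y * deriv P y = of_real k * (w y * deriv q (w y))"
        using kw by (simp add: DERIV_imp_deriv mult_ac)
      then have "\<Phi> (\<omega> y) = q (w y) + of_real (\<delta> * k) * (w y * deriv q (w y))"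
        using \<omega>(2)[OF y1] qw[OF yU] by (simp add: mult.assoc)
      moreover have \<omega>1: "\<omega> y \<in> ball 0 1" using \<omega>(1)[OF y1] y1 by simp
      ultimately have eq: "q (\<omega> y) + of_real \<delta> * (\<omega> y * deriv q (\<omega> y))
          = q (w y) + of_real (\<delta> * k) * (w y * deriv q (w y))" using \<Phi> by simp
      \<comment> \<open>Otherwise \<open>\<omega> y\<close> has the smaller modulus as well as the
        smaller or equal chain parameter, and \<open>chain_disjoint\<close> makes the two points
        equal.\<close>
      have "norm (w y) \<le> norm (\<omega> y)"
      proof (rule ccontr)
        assume lt: "\<not> norm (w y) \<le> norm (\<omega> y)"
        have "\<delta> \<le> \<delta> * k" using \<delta> k by (simp add: mult_le_cancel_left1)
        then have "\<omega> y = w y"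
          using chain_disjoint[OF \<omega>1 w1[OF yU] \<delta> _ _ eq] lt by simp
        then show False using lt by simp
      qed
      then show ?thesis using \<omega>(1)[OF y1] yr by simp
    qed
    then show ?thesis using max[of z] z by simp
  qed
  have U: "U = ball 0 1"
  proof (rule ccontr)
    assume "U \<noteq> ball 0 1"
    then obtain x where x: "x \<in> ball 0 1" "x \<notin> U" using sU by blast
    \<comment> \<open>Let \<open>y\<close> have least modulus among these points outside
      \<open>U\<close>. On the open disc of radius \<open>norm y\<close>, \<open>P\<close> takes
      values in the image of \<open>cball 0 (norm y)\<close> under \<open>q\<close>. This image is
      compact, so it contains \<open>P y\<close> too, which puts \<open>y\<close> into
      \<open>U\<close>.\<close>
    have "compact (cball 0 (norm x) - U)" by (intro compact_diff compact_cball opU)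
    moreover have "cball 0 (norm x) - U \<noteq> {}" using x by auto
    ultimately obtain y where y: "y \<in> cball 0 (norm x) - U"
      and min: "\<And>z. z \<in> cball 0 (norm x) - U \<Longrightarrow> norm y \<le> norm z"
      using continuous_attains_inf[of "cball 0 (norm x) - U" norm] continuous_on_norm_id by metis
    have y1: "norm y < 1" using y x by auto
    have "0 \<in> U" using P0 by (auto simp: U_def)
    then have y0: "y \<noteq> 0" using y by auto
    have inU: "z \<in> U" if "norm z < norm y" for z
      using min[of z] y that by (cases "z \<in> U") auto
    have sub1: "cball 0 (norm y) \<subseteq> ball (0::complex) 1" using y1 by auto
    have "P z \<in> q ` cball 0 (norm y)" if z: "z \<in> ball 0 (norm y)" for z
    proof -
      have "norm (w z) \<le> norm z" using inU z by (intro bound[of "norm z"]) auto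
      then have "w z \<in> cball 0 (norm y)" using z by simp
      then show ?thesis using qw[OF inU] z by (metis dist_0_norm image_eqI mem_ball)
    qed
    then have "P ` closure (ball 0 (norm y)) \<subseteq> q ` cball 0 (norm y)"
    proof (intro image_closure_subset)
      have "continuous_on (cball 0 (norm y)) P" "continuous_on (cball 0 (norm y)) q"
        using holP holo sub1 by (meson continuous_on_subset holomorphic_on_imp_continuous_on)+
      then show "continuous_on (closure (ball 0 (norm y))) P" "closed (q ` cball 0 (norm y))"
        using y0 by (simp, intro compact_imp_closed compact_continuous_image compact_cball)
    qed auto
    moreover have "y \<in> closure (ball 0 (norm y))" using y0 by simp
    ultimately have "P y \<in> q ` ball 0 1" using sub1 by blast
    then show False using y y1 by (simp add: U_def)
  qed
  have "norm (w z) \<le> norm z" if "z \<in> ball 0 1" for z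
    using that U by (intro bound[of "norm z"]) auto
  then show ?thesis unfolding subordinate_def
    using holP holo holw qw U by (intro conjI exI[of _ w]) auto
qed

end

section \<open>Convexity from the hypothesis on \<open>\<Phi>\<close>\<close>

text \<open>\<open>R = q' / \<Phi>'\<close> satisfies the linear equation of
  \<open>Briot_Bouquet_positive\<close> with \<open>P = z * \<Phi>'' / \<Phi>' + 1\<close>. The
  positivity obtained there is convexity, since
  \<open>\<beta> / R - \<beta> = 1 + z * q'' / q'\<close>.\<close>

lemma convex_map_Briot_Bouquet:
  fixes \<beta> :: real
  assumes \<beta>: "0 < \<beta>" and holq: "q holomorphic_on ball 0 1"
    and \<Phi>: "\<And>z. z \<in> ball 0 1 \<Longrightarrow> \<Phi> z = q z + of_real (1 / \<beta>) * (z * deriv q z)"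
    and nz: "\<And>z. z \<in> ball 0 1 \<Longrightarrow> deriv \<Phi> z \<noteq> 0"
    and Re: "\<And>z. z \<in> ball 0 1 \<Longrightarrow>
      - min (\<beta> / 2) (1 / (2 * \<beta>)) < Re (z * deriv (deriv \<Phi>) z / deriv \<Phi> z + 1)"
  shows "convex_map q"
proof -
  define R where "R = (\<lambda>z. deriv q z / deriv \<Phi> z)"
  have holq': "deriv q holomorphic_on ball 0 1" using holq by (rule holomorphic_deriv) simp
  have "(\<lambda>z. q z + of_real (1 / \<beta>) * (z * deriv q z)) holomorphic_on ball 0 1"
    by (intro holomorphic_intros holq holq')
  then have hol\<Phi>: "\<Phi> holomorphic_on ball 0 1"
    by (rule holomorphic_transform) (simp add: \<Phi>)
  then have hol\<Phi>': "deriv \<Phi> holomorphic_on ball 0 1" by (rule holomorphic_deriv) simp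
  have dq': "(deriv q has_field_derivative deriv (deriv q) z) (at z)" if "z \<in> ball 0 1" for z
    using holq' open_ball that by (rule holomorphic_derivI)
  \<comment> \<open>The differentiated relation, times \<open>\<beta>\<close>. It yields the
    equation for \<open>R\<close>, the value \<open>R 0\<close> and the formula for
    \<open>\<beta> / R - \<beta>\<close>.\<close>
  have \<Phi>': "of_real \<beta> * deriv \<Phi> z = (of_real \<beta> + 1) * deriv q z + z * deriv (deriv q) z"
    if z: "z \<in> ball 0 1" for z
  proof -
    have "(q has_field_derivative deriv q z) (at z)" using holq open_ball z by (rule holomorphic_derivI)
    then have "((\<lambda>z. q z + of_real (1 / \<beta>) * (z * deriv q z)) has_field_derivative
        deriv q z + of_real (1 / \<beta>) * (deriv q z + z * deriv (deriv q) z)) (at z)"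
      using dq'[OF z] \<beta> by (auto intro!: derivative_eq_intros)
    then have "(\<Phi> has_field_derivative
        deriv q z + of_real (1 / \<beta>) * (deriv q z + z * deriv (deriv q) z)) (at z)"
      using open_ball z by (rule has_field_derivative_transform_within_open) (simp add: \<Phi>)
    then show ?thesis using \<beta> by (simp add: DERIV_imp_deriv field_simps)
  qed
  have holR: "R holomorphic_on ball 0 1" unfolding R_def
    using nz by (intro holomorphic_intros holq' hol\<Phi>') auto
  have ode: "z * deriv R z + (of_real \<beta> + (z * deriv (deriv \<Phi>) z / deriv \<Phi> z + 1)) * R z = of_real \<beta>"
    if z: "z \<in> ball 0 1" for z
  proof -
    have "(deriv \<Phi> has_field_derivative deriv (deriv \<Phi>) z) (at z)"
      using hol\<Phi>' open_ball z by (rule holomorphic_derivI)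
    then have "(R has_field_derivative
        (deriv (deriv q) z * deriv \<Phi> z - deriv q z * deriv (deriv \<Phi>) z) / (deriv \<Phi> z * deriv \<Phi> z)) (at z)"
      unfolding R_def using dq'[OF z] nz[OF z] by (intro DERIV_divide)
    then have dR: "deriv R z = deriv (deriv q) z / deriv \<Phi> z - deriv (deriv \<Phi>) z / deriv \<Phi> z * R z"
      using nz[OF z] by (simp add: DERIV_imp_deriv R_def diff_divide_distrib)
    have "z * deriv R z + (of_real \<beta> + (z * deriv (deriv \<Phi>) z / deriv \<Phi> z + 1)) * R z
        = ((of_real \<beta> + 1) * deriv q z + z * deriv (deriv q) z) / deriv \<Phi> z"
      unfolding dR by (simp add: R_def algebra_simps add_divide_distrib)
    then show ?thesis unfolding \<Phi>'[OF z, symmetric] using nz[OF z] by simp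
  qed
  have R0: "R 0 = of_real (\<beta> / (\<beta> + 1))"
  proof -
    have "of_real \<beta> * deriv \<Phi> 0 = of_real (\<beta> + 1) * deriv q 0" using \<Phi>'[of 0] by simp
    moreover have "of_real (\<beta> + 1) \<noteq> (0::complex)" using \<beta> by (simp only: of_real_eq_0_iff)
    ultimately have "deriv q 0 = of_real \<beta> * deriv \<Phi> 0 / of_real (\<beta> + 1)" by (simp add: field_simps)
    then show ?thesis using nz[of 0] by (simp add: R_def)
  qed
  note BB = Briot_Bouquet_positive[OF \<beta> holR ode R0 Re]
  show ?thesis
  proof
    fix z :: complex assume z: "z \<in> ball 0 1"
    show q': "deriv q z \<noteq> 0" using BB(1)[OF _ _ z] by (auto simp: R_def)
    have "of_real \<beta> / R z - of_real \<beta> = (of_real \<beta> * deriv \<Phi> z - of_real \<beta> * deriv q z) / deriv q z"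
      using q' by (simp add: R_def diff_divide_distrib)
    also have "\<dots> = 1 + z * deriv (deriv q) z / deriv q z"
      unfolding \<Phi>'[OF z] using q' by (simp add: field_simps)
    finally show "0 < Re (1 + z * deriv (deriv q) z / deriv q z)" using BB(2)[OF _ _ z] by simp
  qed (rule holq)
qed


subsection \<open>The operator\<close>

text \<open>The power series of \<open>B_quot\<close>: dividing by \<open>z\<close> lowers the
  exponents by one, and the separate summand 1 becomes the term \<open>n = 0\<close> when
  \<open>deriv f 0 = 1\<close>.\<close>

definition B_fps :: "real \<Rightarrow> complex \<Rightarrow> (complex \<Rightarrow> complex) \<Rightarrow> complex fps" where
  "B_fps \<nu> c f = Abs_fps (\<lambda>n. fps_nth (fps_expansion f 0) (n + 1) *
     ((- c / 4) ^ n / (pochhammer (of_real \<nu>) n * fact n)))"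

text \<open>All factors after the first exceed 1. This keeps the denominators of
  \<open>B_fps\<close> away from 0.\<close>

lemma pochhammer_ge_min:
  fixes \<nu> :: real
  assumes "0 < \<nu>"
  shows "min 1 \<nu> \<le> pochhammer \<nu> n"
proof (cases n)
  case (Suc m)
  have "\<nu> \<le> pochhammer \<nu> (Suc m)"
  proof (induction m)
    case (Suc m)
    have "\<nu> * 1 \<le> pochhammer \<nu> (Suc m) * (\<nu> + of_nat (Suc m))"
      using Suc assms by (intro mult_mono) auto
    then show ?case by (simp add: pochhammer_Suc)
  qed simp
  then show ?thesis using Suc by simp
qed simp

text \<open>The multipliers of the Taylor coefficients of \<open>f\<close> are bounded:
  \<open>(- c / 4) ^ n / fact n\<close> tends to 0, and the Pochhammer symbol is at least
  \<open>min 1 \<nu>\<close>.\<close>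

lemma B_fps_conv_radius:
  assumes \<nu>: "0 < \<nu>" and hol: "f holomorphic_on ball 0 1"
  shows "1 \<le> fps_conv_radius (B_fps \<nu> c f)"
  unfolding fps_conv_radius_def
proof (rule conv_radius_geI_ex)
  fix r :: real assume r: "0 < r" "ereal r < 1"
  define a where "a = fps_nth (fps_expansion f 0)"
  have "ereal 1 \<le> fps_conv_radius (fps_expansion f 0)"
    using hol by (intro conv_radius_fps_expansion) simp
  moreover have "ereal r < ereal 1" using r by (simp add: one_ereal_def)
  ultimately have "ereal r < conv_radius a" unfolding fps_conv_radius_def a_def by order
  then have "ereal (norm (of_real r :: complex)) < conv_radius a" using r by simp
  then have "summable (\<lambda>n. norm (a n * of_real r ^ n))" by (rule abs_summable_in_conv_radius)
  then have "summable (\<lambda>n. norm (a (Suc n) * of_real r ^ Suc n) / r)"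
    by (subst (asm) summable_Suc_iff[symmetric]) (rule summable_divide)
  then have sum: "summable (\<lambda>n. norm (a (Suc n)) * r ^ n)"
    using r by (simp add: norm_mult norm_power)
  have "(\<lambda>n. inverse (fact n) * (- c / 4) ^ n) \<longlonglongrightarrow> 0"
    by (rule summable_LIMSEQ_zero[OF summable_exp])
  then have "Bseq (\<lambda>n. inverse (fact n) * (- c / 4) ^ n)" by (rule convergent_imp_Bseq[OF convergentI])
  then obtain K where K: "0 < K" "\<And>n. norm (inverse (fact n) * (- c / 4) ^ n) \<le> K" by (auto elim: BseqE)
  have "norm (fps_nth (B_fps \<nu> c f) n * of_real r ^ n) \<le> K / min 1 \<nu> * (norm (a (Suc n)) * r ^ n)" for n
  proof -
    have "norm (fps_nth (B_fps \<nu> c f) n * of_real r ^ n)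
        = norm (inverse (fact n) * (- c / 4) ^ n) / pochhammer \<nu> n * (norm (a (Suc n)) * r ^ n)"
      using r pochhammer_pos[OF \<nu>, of n]
      by (simp add: B_fps_def a_def norm_mult norm_divide norm_power norm_inverse pochhammer_of_real
          divide_simps)
    also have "\<dots> \<le> K / min 1 \<nu> * (norm (a (Suc n)) * r ^ n)"
      using r K(1) K(2)[of n] \<nu> pochhammer_ge_min[OF \<nu>, of n]
      by (intro mult_right_mono frac_le) auto
    finally show ?thesis .
  qed
  then have "summable (\<lambda>n. fps_nth (B_fps \<nu> c f) n * of_real r ^ n)"
    by (intro summable_comparison_test'[OF summable_mult[OF sum, of "K / min 1 \<nu>"], of 0])
  then show "\<exists>z. norm z = r \<and> summable (\<lambda>n. fps_nth (B_fps \<nu> c f) n * z ^ n)"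
    using r by (intro exI[of _ "of_real r"]) simp
qed

lemma less_B_fps_conv_radius:
  assumes "0 < \<nu>" "f holomorphic_on ball 0 1" "norm z < 1"
  shows "ereal (norm z) < fps_conv_radius (B_fps \<nu> c f)"
  using less_le_trans[OF _ B_fps_conv_radius[OF assms(1,2)]] assms(3) by (simp add: one_ereal_def)

lemma eval_B_fps:
  assumes \<nu>: "0 < \<nu>" and f: "f \<in> class_A" and z: "z \<in> ball 0 1"
  shows "eval_fps (B_fps \<nu> c f) z = B_quot (of_real \<nu>) c f z"
proof -
  have hol: "f holomorphic_on ball 0 1" and f1: "deriv f 0 = 1"
    using f by (auto simp: class_A_def univalent_def)
  have F0: "fps_nth (B_fps \<nu> c f) 0 = 1" by (simp add: B_fps_def fps_expansion_def f1)
  have "summable (\<lambda>n. fps_nth (B_fps \<nu> c f) n * z ^ n)"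
    using less_B_fps_conv_radius[OF \<nu> hol] z
    by (intro summable_in_conv_radius) (simp add: fps_conv_radius_def)
  then have split: "eval_fps (B_fps \<nu> c f) z
      = 1 + (\<Sum>n. fps_nth (B_fps \<nu> c f) (Suc n) * z ^ Suc n)"
    and summ: "summable (\<lambda>n. fps_nth (B_fps \<nu> c f) (Suc n) * z ^ Suc n)"
    using suminf_split_head[of "\<lambda>n. fps_nth (B_fps \<nu> c f) n * z ^ n"]
      summable_Suc_iff[of "\<lambda>n. fps_nth (B_fps \<nu> c f) n * z ^ n"]
    by (simp_all add: eval_fps_def F0)
  show ?thesis
  proof (cases "z = 0")
    case True
    then show ?thesis using F0 by (simp add: B_quot_def eval_fps_at_0)
  next
    case False
    have "B_op (of_real \<nu>) c f z = z + (\<Sum>n. z * (fps_nth (B_fps \<nu> c f) (Suc n) * z ^ Suc n))"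
      by (simp add: B_op_def B_fps_def mult_ac)
    also have "\<dots> = z * eval_fps (B_fps \<nu> c f) z"
      unfolding split suminf_mult[OF summ] by (simp add: distrib_left)
    finally show ?thesis using False by (simp add: B_quot_def)
  qed
qed

lemma B_quot_holomorphic:
  assumes \<nu>: "0 < \<nu>" and f: "f \<in> class_A"
  shows "B_quot (of_real \<nu>) c f holomorphic_on ball 0 1"
proof -
  have hol: "f holomorphic_on ball 0 1" using f by (auto simp: class_A_def univalent_def)
  have "eval_fps (B_fps \<nu> c f) holomorphic_on ball 0 1"
    using less_B_fps_conv_radius[OF \<nu> hol]
    by (intro holomorphic_on_eval_fps) (auto simp: in_eball_iff dist_norm)
  then show ?thesis by (rule holomorphic_transform) (simp add: eval_B_fps[OF \<nu> f])
qed

text \<open>From \<open>\<nu> * pochhammer (\<nu> + 1) n = pochhammer \<nu> n * (\<nu> + n)\<close>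
  follows \<open>1 / pochhammer \<nu> n = (1 + n / \<nu>) / pochhammer (\<nu> + 1) n\<close>. The
  factor \<open>n\<close> on coefficients is the operator \<open>z * d/dz\<close>.\<close>

lemma B_fps_recurrence:
  assumes \<nu>: "0 < \<nu>"
  shows "B_fps \<nu> c f = B_fps (\<nu> + 1) c f
    + fps_const (of_real (1 / \<nu>)) * (fps_X * fps_deriv (B_fps (\<nu> + 1) c f))"
proof (rule fps_ext)
  fix n
  define N where "N = pochhammer (of_real \<nu> :: complex) n"
  define M where "M = pochhammer (of_real (\<nu> + 1) :: complex) n"
  have nz: "N \<noteq> 0" "M \<noteq> 0"
    using pochhammer_pos[OF \<nu>, of n] pochhammer_pos[of "\<nu> + 1" n] \<nu>
    unfolding N_def M_def pochhammer_of_real by simp_all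
  have "of_real \<nu> * M = N * (of_real \<nu> + of_nat n)"
    unfolding N_def M_def using pochhammer_rec[of "of_real \<nu> :: complex" n]
    by (simp add: pochhammer_Suc)
  moreover have "1 / M * (1 + of_real (1 / \<nu>) * of_nat n) = (of_real \<nu> + of_nat n) / (of_real \<nu> * M)"
    using nz \<nu> by (simp add: field_simps)
  moreover have "of_real \<nu> + of_nat n \<noteq> (0::complex)"
  proof -
    have "of_real (\<nu> + of_nat n) \<noteq> (0::complex)" unfolding of_real_eq_0_iff using \<nu> by simp
    then show ?thesis by simp
  qed
  ultimately have "1 / N = 1 / M * (1 + of_real (1 / \<nu>) * of_nat n)" by simp
  then have "1 / N * T = 1 / M * T + of_real (1 / \<nu>) * (of_nat n * (1 / M * T))" for T
    by (simp add: algebra_simps)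
  moreover define T where "T = fps_nth (fps_expansion f 0) (n + 1) * ((- c / 4) ^ n / fact n)"
  ultimately have "1 / N * T = 1 / M * T + of_real (1 / \<nu>) * (of_nat n * (1 / M * T))" by blast
  moreover have "fps_nth (B_fps \<nu> c f) n = 1 / N * T" "fps_nth (B_fps (\<nu> + 1) c f) n = 1 / M * T"
    by (simp_all add: B_fps_def N_def M_def T_def)
  moreover have "fps_nth (fps_X * fps_deriv G) n = of_nat n * fps_nth G n" for G :: "complex fps"
    by (cases n) simp_all
  ultimately show "fps_nth (B_fps \<nu> c f) n = fps_nth (B_fps (\<nu> + 1) c f
    + fps_const (of_real (1 / \<nu>)) * (fps_X * fps_deriv (B_fps (\<nu> + 1) c f))) n"
    by (simp only: fps_add_nth fps_mult_left_const_nth)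
qed

lemma B_quot_recurrence:
  assumes \<nu>: "0 < \<nu>" and f: "f \<in> class_A" and z: "z \<in> ball 0 1"
  shows "B_quot (of_real \<nu>) c f z = B_quot (of_real (\<nu> + 1)) c f z
    + of_real (1 / \<nu>) * (z * deriv (B_quot (of_real (\<nu> + 1)) c f) z)"
proof -
  have hol: "f holomorphic_on ball 0 1" using f by (auto simp: class_A_def univalent_def)
  have \<nu>1: "0 < \<nu> + 1" using \<nu> by simp
  define F where "F = B_fps (\<nu> + 1) c f"
  have rad: "ereal (norm z) < fps_conv_radius F"
    unfolding F_def using z by (intro less_B_fps_conv_radius[OF \<nu>1 hol]) simp
  then have rad': "ereal (norm z) < fps_conv_radius (fps_deriv F)"
    using fps_conv_radius_deriv[of F] by (rule less_le_trans)
  have rad'': "ereal (norm z) < fps_conv_radius (fps_X * fps_deriv F)"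
    using rad' fps_conv_radius_mult[of fps_X "fps_deriv F"] by (auto intro: less_le_trans)
  have rad''': "ereal (norm z) < fps_conv_radius (fps_const (of_real (1 / \<nu>)) * (fps_X * fps_deriv F))"
    using rad'' fps_conv_radius_mult[of "fps_const (of_real (1 / \<nu>))" "fps_X * fps_deriv F"]
    by (auto intro: less_le_trans)
  have "eval_fps (fps_deriv F) z = deriv (eval_fps F) z" using rad by (intro eval_fps_deriv) simp
  also have "\<dots> = deriv (B_quot (of_real (\<nu> + 1)) c f) z"
  proof (rule deriv_cong_ev)
    show "\<forall>\<^sub>F x in nhds z. eval_fps F x = B_quot (of_real (\<nu> + 1)) c f x"
      using eventually_nhds_in_open[OF open_ball z]
      by eventually_elim (simp only: F_def eval_B_fps[OF \<nu>1 f])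
  qed simp
  finally have d: "eval_fps (fps_deriv F) z = deriv (B_quot (of_real (\<nu> + 1)) c f) z" .
  have "B_quot (of_real \<nu>) c f z = eval_fps (F + fps_const (of_real (1 / \<nu>)) * (fps_X * fps_deriv F)) z"
    unfolding F_def B_fps_recurrence[OF \<nu>, symmetric] by (rule eval_B_fps[OF \<nu> f z, symmetric])
  also have "\<dots> = eval_fps F z + of_real (1 / \<nu>) * (z * eval_fps (fps_deriv F) z)"
    using rad rad' rad'' rad''' by (simp add: eval_fps_add eval_fps_mult)
  finally show ?thesis unfolding d unfolding F_def eval_B_fps[OF \<nu>1 f z] .
qed

text \<open>With \<open>m = 1 - lam\<close> and \<open>a = \<kappa> + 1\<close>, the square root is
  at least \<open>m\<^sup>2\<close> and at least \<open>a\<^sup>2\<close>, so the numerator is at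
  most \<open>a\<^sup>2\<close> and at most \<open>m\<^sup>2\<close>. Twice these bounds already
  give the two terms of the minimum, as \<open>\<beta> = a / m\<close>.\<close>

lemma gamma_bound_le:
  assumes lam: "lam < 1" and \<kappa>: "- 1 < \<kappa>" and \<beta>: "\<beta> = (\<kappa> + 1) / (1 - lam)"
  shows "gamma_bound lam \<kappa> \<le> min (\<beta> / 2) (1 / (2 * \<beta>))"
proof -
  define m where "m = 1 - lam"
  define a where "a = \<kappa> + 1"
  have pos: "0 < m" "0 < a" using lam \<kappa> by (simp_all add: m_def a_def)
  have "a\<^sup>2 \<le> sqrt (m ^ 4 + a ^ 4)" "m\<^sup>2 \<le> sqrt (m ^ 4 + a ^ 4)"
    by (rule real_le_rsqrt; simp flip: power_mult)+
  then have "m\<^sup>2 + a\<^sup>2 - sqrt (m ^ 4 + a ^ 4) \<le> 2 * m\<^sup>2" "m\<^sup>2 + a\<^sup>2 - sqrt (m ^ 4 + a ^ 4) \<le> 2 * a\<^sup>2"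
    using zero_le_power2[of m] zero_le_power2[of a] by linarith+
  then have "gamma_bound lam \<kappa> \<le> 2 * m\<^sup>2 / (4 * m * a)" "gamma_bound lam \<kappa> \<le> 2 * a\<^sup>2 / (4 * m * a)"
    unfolding gamma_bound_def m_def[symmetric] a_def[symmetric]
    using pos by (intro divide_right_mono; simp)+
  moreover have "2 * m\<^sup>2 / (4 * m * a) = 1 / (2 * \<beta>)" "2 * a\<^sup>2 / (4 * m * a) = \<beta> / 2"
    using pos unfolding \<beta> m_def[symmetric] a_def[symmetric] by (simp_all add: power2_eq_square)
  ultimately show ?thesis by simp
qed

section \<open>The subordination implication and the best dominant\<close>

theorem theorem1:
  fixes f g \<Phi> :: "complex \<Rightarrow> complex" and c :: complex and p b \<kappa> lam :: real
  assumes "f \<in> class_A" and "g \<in> class_A"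
    and "0 \<le> lam" and "lam < 1"
    and "c \<noteq> 0"
    and "\<kappa> = p + (b + 1) / 2" and "\<kappa> > -1"
    and "\<Phi> = B_mix lam \<kappa> c g"
    and "\<forall>z\<in>ball 0 1. deriv \<Phi> z \<noteq> 0 \<and>
           Re (z * deriv (deriv \<Phi>) z / deriv \<Phi> z + 1) > - gamma_bound lam \<kappa>"
  shows "(subordinate (B_mix lam \<kappa> c f) (B_mix lam \<kappa> c g) \<longrightarrow>
            subordinate (B_quot (of_real \<kappa> + 2) c f) (B_quot (of_real \<kappa> + 2) c g)) \<and>
         ds_best_dominant (\<lambda>u v. u + of_real ((1 - lam) / (\<kappa> + 1)) * v) \<Phi>
            (B_quot (of_real \<kappa> + 2) c g)"
proof -
  define \<beta> where "\<beta> = (\<kappa> + 1) / (1 - lam)"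
  define \<delta> where "\<delta> = (1 - lam) / (\<kappa> + 1)"
  have \<beta>: "0 < \<beta>" and \<delta>: "0 \<le> \<delta>" "\<delta> = 1 / \<beta>" using assms(4,7) by (simp_all add: \<beta>_def \<delta>_def)
  have hol: "B_quot (of_real \<kappa> + 2) c h holomorphic_on ball 0 1" if "h \<in> class_A" for h
    using B_quot_holomorphic[of "\<kappa> + 2" h c] that assms(7) by simp
  \<comment> \<open>The recurrence at parameter \<open>\<kappa> + 1\<close>; the weights
    \<open>1 - lam\<close> and \<open>lam\<close> of the underived term add up to 1.\<close>
  have mix: "B_mix lam \<kappa> c h z
      = B_quot (of_real \<kappa> + 2) c h z + of_real \<delta> * (z * deriv (B_quot (of_real \<kappa> + 2) c h) z)"
    if "h \<in> class_A" "z \<in> ball 0 1" for h z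
  proof -
    have "B_quot (of_real \<kappa> + 1) c h z
      = B_quot (of_real \<kappa> + 2) c h z + of_real (1 / (\<kappa> + 1)) * (z * deriv (B_quot (of_real \<kappa> + 2) c h) z)"
      using B_quot_recurrence[of "\<kappa> + 1" h z c] that assms(7) by (simp add: add.assoc)
    moreover have "of_real \<delta> = (1 - of_real lam) * (of_real (1 / (\<kappa> + 1)) :: complex)"
      by (simp add: \<delta>_def)
    ultimately show ?thesis unfolding B_mix_def by (simp only:) (simp only: algebra_simps mult_1)
  qed
  define q where "q = B_quot (of_real \<kappa> + 2) c g"
  have holq: "q holomorphic_on ball 0 1" unfolding q_def using assms(2) by (rule hol)
  have \<Phi>: "\<Phi> z = q z + of_real \<delta> * (z * deriv q z)" if "z \<in> ball 0 1" for z
    unfolding assms(8) q_def using assms(2) that by (rule mix)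
  interpret convex_map q
  proof (rule convex_map_Briot_Bouquet[OF \<beta> holq \<Phi>[unfolded \<delta>(2)]])
    fix z :: complex assume z: "z \<in> ball 0 1"
    show "deriv \<Phi> z \<noteq> 0" using assms(9) z by blast
    show "- min (\<beta> / 2) (1 / (2 * \<beta>)) < Re (z * deriv (deriv \<Phi>) z / deriv \<Phi> z + 1)"
      using assms(9) z gamma_bound_le[OF assms(4) assms(7) \<beta>_def] by fastforce
  qed
  have "(\<lambda>z. q z + of_real \<delta> * (z * deriv q z)) holomorphic_on ball 0 1"
    by (intro holomorphic_intros holq holo_deriv)
  then have hol\<Phi>: "\<Phi> holomorphic_on ball 0 1"
    by (rule holomorphic_transform) (simp add: \<Phi>)
  \<comment> \<open>This is the chain with \<open>s = t = \<delta>\<close>.\<close>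
  have "inj_on \<Phi> (ball 0 1)"
    by (rule inj_onI) (use chain_disjoint[OF _ _ \<delta>(1) order_refl] \<Phi> in simp)
  then have uni\<Phi>: "univalent \<Phi>" using hol\<Phi> by (simp add: univalent_def)
  \<comment> \<open>\<open>q\<close> satisfies the subordination with equality, through the identity
    map. Hence every dominant dominates \<open>q\<close>, which makes \<open>q\<close> the best
    one.\<close>
  have sol: "ds_solution (\<lambda>u v. u + of_real \<delta> * v) \<Phi> q"
    unfolding ds_solution_def subordinate_def using holq hol\<Phi>
  proof (intro conjI exI[of _ "\<lambda>z. z"] ballI)
    show "(\<lambda>z. q z + of_real \<delta> * (z * deriv q z)) holomorphic_on ball 0 1" by fact
  qed (auto simp: \<Phi>)
  have sub: "subordinate P q" if "ds_solution (\<lambda>u v. u + of_real \<delta> * v) \<Phi> P" for P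
    using that unfolding ds_solution_def by (intro subordinate_of_Briot_Bouquet[OF \<delta>(1) _ \<Phi>]) auto
  have "ds_best_dominant (\<lambda>u v. u + of_real \<delta> * v) \<Phi> q"
    unfolding ds_best_dominant_def using uni\<Phi> univalent sub sol by (auto simp: ds_dominant_def)
  moreover have "subordinate (B_quot (of_real \<kappa> + 2) c f) q" if "subordinate (B_mix lam \<kappa> c f) \<Phi>"
  proof (rule sub)
    \<comment> \<open>By \<open>mix\<close> the two functions agree on the disc, so the
      subordination is transferred there pointwise.\<close>
    have "subordinate (\<lambda>z. B_quot (of_real \<kappa> + 2) c f z
        + of_real \<delta> * (z * deriv (B_quot (of_real \<kappa> + 2) c f) z)) \<Phi>"
      using that mix[OF assms(1)] unfolding subordinate_def
      by (metis (no_types, lifting) holomorphic_transform)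
    then show "ds_solution (\<lambda>u v. u + of_real \<delta> * v) \<Phi> (B_quot (of_real \<kappa> + 2) c f)"
      using hol[OF assms(1)] by (simp add: ds_solution_def)
  qed
  ultimately show ?thesis unfolding q_def \<delta>_def assms(8) by blast
qed

end
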